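(* Let $A$ be any AnyFit strategy for the online two-dimensional vector packing problem. Then there exists an input sequence $\sigma$ such that $$|A(\sigma)|\geq \frac{11}{5}\,|\mathrm{OPT}(\sigma)|.$$
   Context: Online two-dimensional vector packing: an input sequence $\sigma=(v_1,v_2,\ldots)$ of vectors $v_i\in[0,1]^2$ is revealed one vector at a time. Each vector must be irrevocably assigned, before the next one arrives, either to an already opened bin or to a newly opened bin. A set of vectors $B$ forms a feasible bin if $\|\sum_{v\in B} v\|_\infty\le 1$, i.e. the coordinate-wise sums are at most $1$. $A(\sigma)$ denotes the packing (set of bins) produced by strategy $A$ on $\sigma$, and $\mathrm{OPT}(\sigma)$ is a packing of the vectors of $\sigma$ into the minimum possible number of feasible bins. An online strategy is an AnyFit strategy if it never opens a new bin unless the current vector does not fit (feasibly) into any already opened bin. *)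

theory Defs
  imports "HOL-Analysis.Analysis" "HOL-Library.Disjoint_Sets"
begin

definition valid_input :: "(real^2) list \<Rightarrow> bool" where
  "valid_input \<sigma> \<longleftrightarrow> (\<forall>v\<in>set \<sigma>. \<forall>i. v $ i \<in> {0..1})"

text \<open>
  Since the same vector may occur several times in an input sequence, a bin is a set of
  positions in the sequence rather than a set of vectors.
\<close>

definition feasible_bin :: "(real^2) list \<Rightarrow> nat set \<Rightarrow> bool" where
  "feasible_bin \<sigma> B \<longleftrightarrow> infnorm (\<Sum>j\<in>B. \<sigma> ! j) \<le> 1"

definition packing :: "(real^2) list \<Rightarrow> nat set set \<Rightarrow> bool" where
  "packing \<sigma> P \<longleftrightarrow> partition_on {..<length \<sigma>} P \<and> (\<forall>B\<in>P. feasible_bin \<sigma> B)"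

definition OPT :: "(real^2) list \<Rightarrow> nat set set" where
  "OPT \<sigma> = arg_min card (packing \<sigma>)"

text \<open>
  A (deterministic) strategy is represented by the map sending each input sequence to the
  packing it produces. It is online iff the packing of a sequence extended by one further
  vector arises from the packing of the sequence itself by putting the new position, which
  is \<^term>\<open>length \<sigma>\<close>, into a new bin or into one of the existing bins.
\<close>

definition opens_new_bin ::
    "((real^2) list \<Rightarrow> nat set set) \<Rightarrow> (real^2) list \<Rightarrow> real^2 \<Rightarrow> bool" where
  "opens_new_bin A \<sigma> v \<longleftrightarrow> A (\<sigma> @ [v]) = insert {length \<sigma>} (A \<sigma>)"

definition puts_into_bin ::
    "((real^2) list \<Rightarrow> nat set set) \<Rightarrow> (real^2) list \<Rightarrow> real^2 \<Rightarrow> nat set \<Rightarrow> bool" where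
  "puts_into_bin A \<sigma> v B \<longleftrightarrow>
     A (\<sigma> @ [v]) = insert (insert (length \<sigma>) B) (A \<sigma> - {B})"

definition online_strategy :: "((real^2) list \<Rightarrow> nat set set) \<Rightarrow> bool" where
  "online_strategy A \<longleftrightarrow>
     (\<forall>\<sigma>. valid_input \<sigma> \<longrightarrow> packing \<sigma> (A \<sigma>)) \<and>
     (\<forall>\<sigma> v. valid_input (\<sigma> @ [v]) \<longrightarrow>
        opens_new_bin A \<sigma> v \<or> (\<exists>B\<in>A \<sigma>. puts_into_bin A \<sigma> v B))"

definition any_fit :: "((real^2) list \<Rightarrow> nat set set) \<Rightarrow> bool" where
  "any_fit A \<longleftrightarrow> online_strategy A \<and>
     (\<forall>\<sigma> v. valid_input (\<sigma> @ [v]) \<longrightarrow> opens_new_bin A \<sigma> v \<longrightarrow>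
        (\<forall>B\<in>A \<sigma>. \<not> feasible_bin (\<sigma> @ [v]) (insert (length \<sigma>) B)))"

end

theory Submission imports Defs begin

text \<open>
  Every AnyFit strategy is forced on an input with three kinds of vectors, given in eighths:
  \<open>48\<close> copies of \<open>(0,1)\<close>, then \<open>8\<close> copies of \<open>(3,1)\<close>, then \<open>8\<close> copies of \<open>(5,1)\<close>.
  The first kind fills \<open>6\<close> bins completely in the second coordinate, so they block everything
  that follows. Three vectors \<open>(3,1)\<close> do not fit together, hence they occupy \<open>4\<close> bins of load
  \<open>(6,2)\<close>, and every \<open>(5,1)\<close> then needs a bin of its own. This gives \<open>6 + 4 + 8 = 18\<close> bins,
  whereas \<open>8\<close> bins of load \<open>(8,8)\<close> suffice.
\<close>

section \<open>Bin loads and the feasibility test\<close>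

definition load :: "(real^2) list \<Rightarrow> nat set \<Rightarrow> real^2" where
  "load \<sigma> B = (\<Sum>j\<in>B. \<sigma> ! j)"

text \<open>Phrased through loads only: to see that a vector fits nowhere, it is enough to know
  which loads occur in the current packing.\<close>

definition blocked :: "((real^2) list \<Rightarrow> nat set set) \<Rightarrow> (real^2) list \<Rightarrow> real^2 \<Rightarrow> bool" where
  "blocked A \<sigma> v \<longleftrightarrow> (\<forall>B\<in>A \<sigma>. \<not> infnorm (load \<sigma> B + v) \<le> 1)"

lemma load_append: "B \<subseteq> {..<length \<sigma>} \<Longrightarrow> load (\<sigma> @ \<tau>) B = load \<sigma> B"
  unfolding load_def by (rule sum.cong) (auto simp: nth_append)

lemma load_snoc:
  assumes "B \<subseteq> {..<length \<sigma>}"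
  shows "load (\<sigma> @ [v]) (insert (length \<sigma>) B) = load \<sigma> B + v"
proof -
  have "finite B" "length \<sigma> \<notin> B"
    using assms finite_subset by auto
  then show ?thesis
    using load_append[OF assms, of "[v]"] by (simp add: load_def add.commute)
qed

lemma load_replicate:
  "load (\<sigma> @ replicate k v) {length \<sigma>..<length \<sigma> + k} = real k *\<^sub>R v"
proof -
  have "load (\<sigma> @ replicate k v) {length \<sigma>..<length \<sigma> + k}
      = (\<Sum>j\<in>{length \<sigma>..<length \<sigma> + k}. v)"
    unfolding load_def by (rule sum.cong) (auto simp: nth_append)
  then show ?thesis
    by (simp only: sum_constant_scaleR card_atLeastLessThan add_diff_cancel_left')
qed

lemma infnorm_le_1_iff: "infnorm (x::real^2) \<le> 1 \<longleftrightarrow> \<bar>x$1\<bar> \<le> 1 \<and> \<bar>x$2\<bar> \<le> 1"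
proof -
  have "{\<bar>x$i\<bar> | i. i \<in> UNIV} = {\<bar>x$1\<bar>, \<bar>x$2\<bar>}"
    by (auto simp: exhaust_2) (metis exhaust_2)
  then show ?thesis
    by (simp add: infnorm_cart cSup_eq_Max)
qed

lemma valid_input_append:
  "valid_input (\<sigma> @ \<tau>) \<longleftrightarrow> valid_input \<sigma> \<and> valid_input \<tau>"
  by (auto simp: valid_input_def)

lemma valid_input_replicate:
  "valid_input [v] \<Longrightarrow> valid_input (replicate k v)"
  by (auto simp: valid_input_def)

section \<open>Runs of equal vectors under an AnyFit strategy\<close>

context
  fixes A :: "(real^2) list \<Rightarrow> nat set set"
  assumes af: "any_fit A"
begin

lemma any_fit_packing: "valid_input \<sigma> \<Longrightarrow> packing \<sigma> (A \<sigma>)"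
  using af by (auto simp: any_fit_def online_strategy_def)

lemma any_fit_bin_subset: "valid_input \<sigma> \<Longrightarrow> B \<in> A \<sigma> \<Longrightarrow> B \<subseteq> {..<length \<sigma>}"
  using any_fit_packing unfolding packing_def partition_on_def by blast

lemma any_fit_finite: "valid_input \<sigma> \<Longrightarrow> finite (A \<sigma>)"
  using any_fit_packing finite_elements unfolding packing_def by blast

lemma any_fit_Nil: "A [] = {}"
  using any_fit_packing[of "[]"] by (auto simp: valid_input_def packing_def partition_on_def)

lemma any_fit_feasible_snoc_iff:
  assumes "valid_input \<sigma>" "B \<in> A \<sigma>"
  shows "feasible_bin (\<sigma> @ [v]) (insert (length \<sigma>) B) \<longleftrightarrow> infnorm (load \<sigma> B + v) \<le> 1"
  using load_snoc[OF any_fit_bin_subset[OF assms], of v] by (simp add: feasible_bin_def load_def)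

text \<open>In the first case the AnyFit rule excludes every open bin. In the second, the chosen bin
  has room because the packing of the extended input is feasible.\<close>

lemma any_fit_cases:
  assumes "valid_input (\<sigma> @ [v])"
  obtains (new) "blocked A \<sigma> v" "A (\<sigma> @ [v]) = insert {length \<sigma>} (A \<sigma>)"
    | (old) B where "B \<in> A \<sigma>" "infnorm (load \<sigma> B + v) \<le> 1"
        "A (\<sigma> @ [v]) = insert (insert (length \<sigma>) B) (A \<sigma> - {B})"
proof -
  have v: "valid_input \<sigma>"
    using assms by (simp add: valid_input_append)
  consider "opens_new_bin A \<sigma> v" | B where "B \<in> A \<sigma>" "puts_into_bin A \<sigma> v B"
    using af assms unfolding any_fit_def online_strategy_def by blast
  then show ?thesis
  proof cases
    case 1
    then have "\<forall>B\<in>A \<sigma>. \<not> feasible_bin (\<sigma> @ [v]) (insert (length \<sigma>) B)"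
      using af assms unfolding any_fit_def by blast
    with 1 show ?thesis
      by (intro new) (auto simp: blocked_def opens_new_bin_def any_fit_feasible_snoc_iff[OF v])
  next
    case 2
    have "feasible_bin (\<sigma> @ [v]) (insert (length \<sigma>) B)"
      using any_fit_packing[OF assms] 2 by (auto simp: packing_def puts_into_bin_def)
    with 2 show ?thesis
      by (intro old) (auto simp: puts_into_bin_def any_fit_feasible_snoc_iff[OF v])
  qed
qed

text \<open>The first copy must open a bin. The older bins keep their loads and so stay blocked,
  while the new bin still has room; hence each further copy is forced into it.\<close>

lemma any_fit_fill_one_bin:
  assumes "valid_input \<sigma>" "valid_input [v]" "blocked A \<sigma> v"
    and fits: "infnorm (real (Suc k) *\<^sub>R v) \<le> 1"
  shows "A (\<sigma> @ replicate (Suc k) v) = insert {length \<sigma>..<length \<sigma> + Suc k} (A \<sigma>)"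
  using fits
proof (induction k)
  case 0
  have "valid_input (\<sigma> @ [v])"
    using assms by (simp add: valid_input_append)
  then show ?case
  proof (cases rule: any_fit_cases)
    case (old B)
    with assms(3) show ?thesis by (auto simp: blocked_def)
  qed auto
next
  case (Suc k)
  let ?\<tau> = "\<sigma> @ replicate (Suc k) v" and ?N = "{length \<sigma>..<length \<sigma> + Suc k}"
  have "real (Suc k) * infnorm v \<le> real (Suc (Suc k)) * infnorm v"
    by (intro mult_right_mono infnorm_pos_le) simp
  with Suc.prems have "infnorm (real (Suc k) *\<^sub>R v) \<le> 1"
    by (simp add: infnorm_mul)
  then have IH: "A ?\<tau> = insert ?N (A \<sigma>)"
    by (rule Suc.IH)
  have lN: "load ?\<tau> ?N + v = real (Suc (Suc k)) *\<^sub>R v"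
    by (subst load_replicate) (simp add: vec_eq_iff algebra_simps)
  have snoc: "\<sigma> @ replicate (Suc (Suc k)) v = ?\<tau> @ [v]"
    by (simp add: replicate_append_same)
  have "valid_input (?\<tau> @ [v])"
    using assms valid_input_replicate by (simp only: valid_input_append)
  then show ?case
  proof (cases rule: any_fit_cases)
    case new
    with IH lN Suc.prems show ?thesis by (auto simp: blocked_def simp del: replicate_Suc)
  next
    case (old B)
    have "B \<notin> A \<sigma>"
    proof
      assume B: "B \<in> A \<sigma>"
      with assms old(2) show False
        by (simp add: blocked_def load_append[OF any_fit_bin_subset[OF assms(1) B]]
              del: replicate_Suc)
    qed
    with old(1) IH have B: "B = ?N" by blast
    \<comment> \<open>Freshness of \<open>?N\<close> ensures that replacing it by the enlarged bin
      leaves exactly \<open>A \<sigma>\<close> as the rest of the packing.\<close>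
    have "?N \<notin> A \<sigma>"
      using any_fit_bin_subset[OF assms(1), of ?N] by fastforce
    moreover have "insert (length ?\<tau>) ?N = {length \<sigma>..<length \<sigma> + Suc (Suc k)}"
      by auto
    ultimately show ?thesis
      using old(3) IH B unfolding snoc by (metis Diff_insert_absorb Diff_insert2 insert_Diff_single)
  qed
qed

text \<open>Once a bin holds \<open>c\<close> copies, \<open>full\<close> makes it block
  \<open>v\<close> as well, so the situation at the start recurs and each round of \<open>c\<close>
  copies costs one bin. The load bound is what allows the next kind of vector to be checked for
  blocking.\<close>

lemma any_fit_fill_bins:
  assumes "valid_input \<sigma>" "valid_input [v]" "blocked A \<sigma> v" "c > 0"
    and fits: "infnorm (real c *\<^sub>R v) \<le> 1"
    and full: "\<not> infnorm (real (Suc c) *\<^sub>R v) \<le> 1"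
  defines "\<tau> \<equiv> \<lambda>q. \<sigma> @ replicate (q * c) v"
  shows "card (A (\<tau> q)) = card (A \<sigma>) + q
       \<and> load (\<tau> q) ` A (\<tau> q) \<subseteq> insert (real c *\<^sub>R v) (load \<sigma> ` A \<sigma>)"
proof (induction q)
  case 0
  then show ?case by (auto simp: \<tau>_def)
next
  case (Suc q)
  let ?N = "{length (\<tau> q)..<length (\<tau> q) + c}"
  have valid: "valid_input (\<tau> q)"
    using assms valid_input_replicate by (simp add: valid_input_append \<tau>_def)
  have split: "\<tau> (Suc q) = \<tau> q @ replicate c v"
    by (simp add: \<tau>_def add.commute[of c] replicate_add)
  have "real c *\<^sub>R v + v = real (Suc c) *\<^sub>R v"
    by (simp add: vec_eq_iff algebra_simps)
  \<comment> \<open>Every bin has either load \<open>c\<close> times \<open>v\<close>, excluded by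
    \<open>full\<close>, or the load of a bin of \<open>A \<sigma>\<close>, excluded by
    \<open>assms(3)\<close>.\<close>
  with Suc.IH full assms(3) have "blocked A (\<tau> q) v"
    unfolding blocked_def by (smt (verit) image_iff image_subset_iff insert_iff)
  then have new: "A (\<tau> (Suc q)) = insert ?N (A (\<tau> q))"
    using any_fit_fill_one_bin[OF valid assms(2), of "c - 1"] fits \<open>c > 0\<close> split by simp
  have "?N \<notin> A (\<tau> q)"
    using any_fit_bin_subset[OF valid, of ?N] \<open>c > 0\<close> by fastforce
  then have "card (A (\<tau> (Suc q))) = Suc (card (A (\<tau> q)))"
    using any_fit_finite[OF valid] new by simp
  moreover have "load (\<tau> (Suc q)) B = load (\<tau> q) B" if "B \<in> A (\<tau> q)" for B
    using load_append[OF any_fit_bin_subset[OF valid that]] split by simp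
  moreover have "load (\<tau> (Suc q)) ?N = real c *\<^sub>R v"
    unfolding split by (rule load_replicate)
  ultimately show ?case
    using Suc.IH new by auto
qed

end

section \<open>The hard input and its optimum\<close>

lemma card_OPT_le: "packing \<sigma> P \<Longrightarrow> card (OPT \<sigma>) \<le> card P"
  unfolding OPT_def by (rule arg_min_nat_le)

definition hard_input :: "(real^2) list" where
  "hard_input = replicate 48 (vector [0, 1/8]) @ replicate 8 (vector [3/8, 1/8])
     @ replicate 8 (vector [5/8, 1/8])"

lemma length_hard_input: "length hard_input = 64"
  by (simp add: hard_input_def)

lemma valid_hard_input: "valid_input hard_input"
  by (auto simp: valid_input_def hard_input_def forall_2 vector_2)

text \<open>
  Both \<open>48\<close> and \<open>8\<close> being multiples of \<open>8\<close>, each residue class modulo \<open>8\<close> receives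
  \<open>6 + 1 + 1\<close> vectors of the three kinds.
\<close>

lemma card_OPT_hard_input: "card (OPT hard_input) \<le> 8"
proof -
  define bin where "bin i = (\<lambda>k. i + 8 * k) ` {..<8::nat}" for i :: nat
  have mod_bin: "x mod 8 = i" if "x \<in> bin i" "i < 8" for x i
    using that by (auto simp: bin_def)
  have "load hard_input (bin i) = vector [1, 1]" if "i < 8" for i
  proof -
    have "load hard_input (bin i) = (\<Sum>k<8. hard_input ! (i + 8 * k))"
      unfolding load_def bin_def by (subst sum.reindex) (auto simp: inj_on_def)
    \<comment> \<open>The terms for \<open>k = 7\<close> and \<open>k = 6\<close> are split off:
      they lie in the third and second block of the input, all others in the first.\<close>
    also have "\<dots> = hard_input ! (i + 56) + (hard_input ! (i + 48)
        + (\<Sum>k<6. hard_input ! (i + 8 * k)))"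
    proof -
      have "{..<8} = insert 7 (insert 6 {..<6::nat})"
        by auto
      then show ?thesis
        by simp
    qed
    also have "(\<Sum>k<6. hard_input ! (i + 8 * k)) = (\<Sum>k<6::nat. vector [0, 1/8])"
      using that by (intro sum.cong) (auto simp: hard_input_def nth_append)
    also have "hard_input ! (i + 56) + (hard_input ! (i + 48) + \<dots>) = vector [1, 1]"
      using that
      by (simp add: hard_input_def nth_append vec_eq_iff forall_2 vector_2)
    finally show ?thesis .
  qed
  then have "feasible_bin hard_input (bin i)" if "i < 8" for i
    using that by (simp add: feasible_bin_def load_def infnorm_le_1_iff vector_2)
  moreover have "partition_on {..<length hard_input} (bin ` {..<8})"
  proof (rule partition_onI)
    show "\<Union> (bin ` {..<8}) = {..<length hard_input}"
    proof (intro equalityI subsetI)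
      fix x assume "x \<in> {..<length hard_input}"
      then have "x = x mod 8 + 8 * (x div 8)" "x div 8 < 8" "x mod 8 < 8"
        by (auto simp: length_hard_input)
      then show "x \<in> \<Union> (bin ` {..<8})"
        unfolding bin_def by blast
    qed (auto simp: bin_def length_hard_input)
  next
    fix p q assume "p \<in> bin ` {..<8}" "q \<in> bin ` {..<8}" "p \<noteq> q"
    then obtain i j where "i < 8" "j < 8" "p = bin i" "q = bin j" "i \<noteq> j"
      by auto
    then show "disjnt p q"
      using mod_bin[of _ i] mod_bin[of _ j] unfolding disjnt_iff by metis
  qed (auto simp: bin_def)
  ultimately have "packing hard_input (bin ` {..<8})"
    by (auto simp: packing_def)
  then have "card (OPT hard_input) \<le> card (bin ` {..<8})"
    by (rule card_OPT_le)
  also have "\<dots> \<le> 8"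
    using card_image_le[of "{..<8::nat}" bin] by simp
  finally show ?thesis .
qed

section \<open>The cost of an AnyFit strategy on the hard input\<close>

lemma any_fit_card_hard_input:
  assumes "any_fit A"
  shows "card (A hard_input) = 18"
proof -
  define u v w :: "real^2" where "u = vector [0, 1/8]" and "v = vector [3/8, 1/8]"
    and "w = vector [5/8, 1/8]"
  note defs = u_def v_def w_def
  define \<sigma>\<^sub>1 where "\<sigma>\<^sub>1 = replicate 48 u"
  define \<sigma>\<^sub>2 where "\<sigma>\<^sub>2 = \<sigma>\<^sub>1 @ replicate 8 v"
  define \<sigma>\<^sub>3 where "\<sigma>\<^sub>3 = \<sigma>\<^sub>2 @ replicate 8 w"
  have valid: "valid_input []" "valid_input [u]" "valid_input [v]" "valid_input [w]"
    by (simp_all add: valid_input_def defs forall_2 vector_2)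
  have valid1: "valid_input \<sigma>\<^sub>1" and valid2: "valid_input \<sigma>\<^sub>2"
    using valid valid_input_replicate
    by (simp_all add: \<sigma>\<^sub>1_def \<sigma>\<^sub>2_def valid_input_append)
  have s1: "card (A \<sigma>\<^sub>1) = 6" "load \<sigma>\<^sub>1 ` A \<sigma>\<^sub>1 \<subseteq> {8 *\<^sub>R u}"
    using any_fit_fill_bins[OF assms valid(1,2), of 8 6] any_fit_Nil[OF assms]
    by (simp_all add: blocked_def infnorm_le_1_iff defs vector_2 \<sigma>\<^sub>1_def)
  \<comment> \<open>Adding \<open>v\<close> to \<open>8 *\<^sub>R u\<close> gives second coordinate
    9/8.\<close>
  then have "blocked A \<sigma>\<^sub>1 v"
    by (fastforce simp: blocked_def infnorm_le_1_iff defs vector_2 image_subset_iff)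
  then have "card (A \<sigma>\<^sub>2) = 10
      \<and> load \<sigma>\<^sub>2 ` A \<sigma>\<^sub>2 \<subseteq> insert (2 *\<^sub>R v) (load \<sigma>\<^sub>1 ` A \<sigma>\<^sub>1)"
    \<comment> \<open>Two copies of \<open>v\<close> per bin, four bins: a third copy would give
      first coordinate 9/8.\<close>
    using any_fit_fill_bins[OF assms valid1 valid(3), of 2 4] s1(1)
    by (simp add: infnorm_le_1_iff defs vector_2 \<sigma>\<^sub>2_def)
  with s1(2) have s2: "card (A \<sigma>\<^sub>2) = 10"
    "load \<sigma>\<^sub>2 ` A \<sigma>\<^sub>2 \<subseteq> {8 *\<^sub>R u, 2 *\<^sub>R v}"
    by blast+
  \<comment> \<open>The load \<open>8 *\<^sub>R u\<close> fails in the second coordinate (9/8),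
    \<open>2 *\<^sub>R v\<close> in the first (11/8).\<close>
  then have "blocked A \<sigma>\<^sub>2 w"
    by (fastforce simp: blocked_def infnorm_le_1_iff defs vector_2 image_subset_iff)
  then have "card (A \<sigma>\<^sub>3) = 18"
    using any_fit_fill_bins[OF assms valid2 valid(4), of 1 8] s2
    by (simp add: infnorm_le_1_iff defs vector_2 \<sigma>\<^sub>3_def)
  then show ?thesis
    by (simp add: hard_input_def \<sigma>\<^sub>1_def \<sigma>\<^sub>2_def \<sigma>\<^sub>3_def defs)
qed

theorem theorem1:
  fixes A :: "(real^2) list \<Rightarrow> nat set set"
  assumes "any_fit A"
  shows "\<exists>\<sigma>. \<sigma> \<noteq> [] \<and> valid_input \<sigma> \<and>
           real (card (A \<sigma>)) \<ge> 11 / 5 * real (card (OPT \<sigma>))"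
proof (intro exI conjI)
  show "hard_input \<noteq> []"
    using length_hard_input by auto
  show "valid_input hard_input"
    by (rule valid_hard_input)
  \<comment> \<open>The ratio obtained is at least 18/8 = 9/4, which exceeds 11/5.\<close>
  show "real (card (A hard_input)) \<ge> 11 / 5 * real (card (OPT hard_input))"
    using any_fit_card_hard_input[OF assms] card_OPT_hard_input by simp
qed

end
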